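(* Let $t\in[k]$ be a fixed constant. Draw $T_1,\dots,T_t\in[k]$ independently with $\mathrm{Prob}[T_j=i]=\lambda_i$ for all $i\in[k]$, $j\in[t]$, let $\mathcal{T}$ be the resulting multiset, and let $S_1^{\mathcal{T}}$ be the set of all averages $\frac1t\sum_{r\in[t]}\bm{y}_r$ with $\bm{y}_r\in\Xi_{T_r}$ for every $r\in[t]$. Then $$\mathbb{E}_{\mathcal{T}}\big[v(S_1^{\mathcal{T}})\big]\le\Big(1+\frac1t\Big)v^* .$$
   Context: Notation: $[k]=\{1,\dots,k\}$. For $i\in[k]$, $\mathbb{P}_i=\sum_{j\in[|\Xi_i|]}\hat p_{ij}\delta_{\hat{\bm{x}}_{ij}}$ is a probability measure supported on a nonempty finite set $\Xi_i=\{\hat{\bm{x}}_{ij}\}_j\subseteq\mathbb{R}^d$ with $|\Xi_i|\le n$. Weights $\bm\lambda=(\lambda_1,\dots,\lambda_k)$ satisfy $\lambda_i\ge0$ and $\sum_{i\in[k]}\lambda_i=1$. The barycenter value is $v^*=\inf_{\mathbb{P}}\sum_{i\in[k]}\lambda_iW_2^2(\mathbb{P},\mathbb{P}_i)$, the infimum over Borel probability measures on $\mathbb{R}^d$ with finite second moment, where $W_2$ is the type-2 Wasserstein distance for the Euclidean norm. For a nonempty finite set $S\subseteq\mathbb{R}^d$ and $\vec{\bm{j}}=(j_1,\dots,j_k)$ with $j_i\in[|\Xi_i|]$, put $C_{\vec{\bm{j}}}(S)=\min_{\bm{w}\in S}\sum_{i\in[k]}\lambda_i\|\hat{\bm{x}}_{i,j_i}-\bm{w}\|_2^2$,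 and define $$v(S)=\max_{\bm\gamma}\Big\{\sum_{i\in[k]}\sum_{j\in[|\Xi_i|]}\hat p_{ij}\gamma_{ij}:\ C_{\vec{\bm{j}}}(S)-\sum_{i\in[k]}\gamma_{ij_i}\ge0\ \ \forall\,\vec{\bm{j}}\in\prod_{i\in[k]}[|\Xi_i|]\Big\}.$$ This is the linear-programming dual of (and has the same value as) the problem of minimizing $\sum_{\vec{\bm{j}}}C_{\vec{\bm{j}}}(S)\Pi_{\vec{\bm{j}}}$ over nonnegative tensors $\bm\Pi$ whose $i$-th marginal is $(\hat p_{ij})_j$ for every $i\in[k]$. If the same index is drawn several times, the atoms $\bm{y}_r$ for the different positions $r$ are chosen independently of each other. *)

theory Defs
  imports "HOL-Probability.Probability"
begin

text \<open>
  Indices are 1-based: \<open>i \<in> {1..k}\<close> numbers the measures, and \<open>j \<in> {1..m i}\<close> numbers the atoms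
  \<open>x i j\<close> of the \<open>i\<close>-th measure, which carry the probabilities \<open>p i j\<close>. Values of \<open>m\<close>, \<open>x\<close>, \<open>p\<close>
  and of the weights \<open>lam\<close> outside these ranges are irrelevant.
\<close>

definition atomic_measure ::
    "(nat \<Rightarrow> nat) \<Rightarrow> (nat \<Rightarrow> nat \<Rightarrow> real ^ 'd) \<Rightarrow> (nat \<Rightarrow> nat \<Rightarrow> real) \<Rightarrow> nat \<Rightarrow> (real ^ 'd) measure" where
  "atomic_measure m x p i = distr (point_measure {1..m i} (\<lambda>j. ennreal (p i j))) borel (x i)"

definition finite_second_moment_measures :: "(real ^ 'd) measure set" where
  "finite_second_moment_measures =
     {\<mu>. prob_space \<mu> \<and> sets \<mu> = sets borel \<and> integrable \<mu> (\<lambda>z. (norm z)\<^sup>2)}"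

definition couplings ::
    "(real ^ 'd) measure \<Rightarrow> (real ^ 'd) measure \<Rightarrow> ((real ^ 'd) \<times> (real ^ 'd)) measure set" where
  "couplings \<mu> \<nu> =
     {\<pi>. prob_space \<pi> \<and> sets \<pi> = sets borel \<and> distr \<pi> borel fst = \<mu> \<and> distr \<pi> borel snd = \<nu>}"

text \<open>
  The infimum is taken in \<^typ>\<open>ennreal\<close>. It is finite whenever both measures have a finite second
  moment (lemma \<open>transport_cost_finite\<close> below), so the truncation done by \<^const>\<open>enn2real\<close> plays
  no role there.
\<close>

definition W2 :: "(real ^ 'd) measure \<Rightarrow> (real ^ 'd) measure \<Rightarrow> real" where
  "W2 \<mu> \<nu> = sqrt (enn2real
     (INF \<pi>\<in>couplings \<mu> \<nu>. \<integral>\<^sup>+ z. ennreal ((norm (fst z - snd z))\<^sup>2) \<partial>\<pi>))"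

definition barycenter_value ::
    "nat \<Rightarrow> (nat \<Rightarrow> nat) \<Rightarrow> (nat \<Rightarrow> nat \<Rightarrow> real ^ 'd) \<Rightarrow> (nat \<Rightarrow> nat \<Rightarrow> real) \<Rightarrow> (nat \<Rightarrow> real) \<Rightarrow> real" where
  "barycenter_value k m x p lam =
     (INF \<mu>\<in>finite_second_moment_measures.
        \<Sum>i\<in>{1..k}. lam i * (W2 \<mu> (atomic_measure m x p i))\<^sup>2)"

definition support_cost ::
    "nat \<Rightarrow> (nat \<Rightarrow> nat \<Rightarrow> real ^ 'd) \<Rightarrow> (nat \<Rightarrow> real) \<Rightarrow> (real ^ 'd) set \<Rightarrow> (nat \<Rightarrow> nat) \<Rightarrow> real" where
  "support_cost k x lam S J =
     (MIN w\<in>S. \<Sum>i\<in>{1..k}. lam i * (norm (x i (J i) - w))\<^sup>2)"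

definition dual_feasible ::
    "nat \<Rightarrow> (nat \<Rightarrow> nat) \<Rightarrow> (nat \<Rightarrow> nat \<Rightarrow> real ^ 'd) \<Rightarrow> (nat \<Rightarrow> real) \<Rightarrow> (real ^ 'd) set
       \<Rightarrow> (nat \<Rightarrow> nat \<Rightarrow> real) set" where
  "dual_feasible k m x lam S =
     {\<gamma>. \<forall>J\<in>(\<Pi>\<^sub>E i\<in>{1..k}. {1..m i}). support_cost k x lam S J - (\<Sum>i\<in>{1..k}. \<gamma> i (J i)) \<ge> 0}"

text \<open>
  The maximum of a feasible linear program with bounded objective is written as the supremum of its
  objective values; this set is nonempty and bounded above by the lemmas
  \<open>dual_feasible_nonempty\<close> and \<open>dual_objective_bdd_above\<close> below.
\<close>

definition dual_value ::
    "nat \<Rightarrow> (nat \<Rightarrow> nat) \<Rightarrow> (nat \<Rightarrow> nat \<Rightarrow> real ^ 'd) \<Rightarrow> (nat \<Rightarrow> nat \<Rightarrow> real) \<Rightarrow> (nat \<Rightarrow> real)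
       \<Rightarrow> (real ^ 'd) set \<Rightarrow> real" where
  "dual_value k m x p lam S =
     (SUP \<gamma>\<in>dual_feasible k m x lam S. \<Sum>i\<in>{1..k}. \<Sum>j\<in>{1..m i}. p i j * \<gamma> i j)"

definition sampled_averages ::
    "nat \<Rightarrow> (nat \<Rightarrow> nat) \<Rightarrow> (nat \<Rightarrow> nat \<Rightarrow> real ^ 'd) \<Rightarrow> (nat \<Rightarrow> nat) \<Rightarrow> (real ^ 'd) set" where
  "sampled_averages t m x T =
     {(1 / real t) *\<^sub>R (\<Sum>r\<in>{1..t}. y r) | y. \<forall>r\<in>{1..t}. y r \<in> x (T r) ` {1..m (T r)}}"

lemma emeasure_atomic_measure:
  assumes "A \<in> sets borel"
  shows "emeasure (atomic_measure m x p i) A = (\<Sum>j\<in>{1..m i}. ennreal (p i j) * indicator A (x i j))"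
proof -
  have "emeasure (atomic_measure m x p i) A =
      emeasure (point_measure {1..m i} (\<lambda>j. ennreal (p i j))) {j\<in>{1..m i}. x i j \<in> A}"
    unfolding atomic_measure_def using assms
    by (subst emeasure_distr)
       (auto simp: point_measure_def space_density intro!: arg_cong2[where f = emeasure])
  also have "\<dots> = (\<Sum>j\<in>{j\<in>{1..m i}. x i j \<in> A}. ennreal (p i j))"
    by (rule emeasure_point_measure_finite) auto
  also have "\<dots> = (\<Sum>j\<in>{1..m i}. ennreal (p i j) * indicator A (x i j))"
    by (rule sum.mono_neutral_cong_left) (auto simp: indicator_def)
  finally show ?thesis .
qed

lemma atomic_measure_in_finite_second_moment_measures:
  assumes "\<forall>j\<in>{1..m i}. 0 \<le> p i j" and "(\<Sum>j\<in>{1..m i}. p i j) = 1"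
  shows "atomic_measure m x p i \<in> finite_second_moment_measures"
proof -
  have "emeasure (atomic_measure m x p i) UNIV = (\<Sum>j\<in>{1..m i}. ennreal (p i j))"
    by (subst emeasure_atomic_measure) auto
  also have "\<dots> = ennreal (\<Sum>j\<in>{1..m i}. p i j)"
    using assms(1) by (intro sum_ennreal) auto
  finally have "prob_space (atomic_measure m x p i)"
    using assms(2) by (intro prob_spaceI) (auto simp: atomic_measure_def)
  moreover have "integrable (atomic_measure m x p i) (\<lambda>z. (norm z)\<^sup>2)"
    unfolding atomic_measure_def
    by (subst integrable_distr_eq)
       (use assms(1) in \<open>auto simp: point_measure_def integrable_density AE_count_space
          intro!: integrable_count_space\<close>)
  ultimately show ?thesis
    by (simp add: finite_second_moment_measures_def atomic_measure_def)
qed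

lemma transport_cost_finite:
  fixes \<mu> \<nu> :: "(real ^ 'd) measure"
  assumes "\<mu> \<in> finite_second_moment_measures" and "\<nu> \<in> finite_second_moment_measures"
  shows "(INF \<pi>\<in>couplings \<mu> \<nu>. \<integral>\<^sup>+ z. ennreal ((norm (fst z - snd z))\<^sup>2) \<partial>\<pi>) < \<infinity>"
proof -
  let ?\<pi> = "\<mu> \<Otimes>\<^sub>M \<nu>"
  have mu: "prob_space \<mu>" "sets \<mu> = sets borel" "integrable \<mu> (\<lambda>z. (norm z)\<^sup>2)"
    and nu: "prob_space \<nu>" "sets \<nu> = sets borel" "integrable \<nu> (\<lambda>z. (norm z)\<^sup>2)"
    using assms by (auto simp: finite_second_moment_measures_def)
  interpret mu: prob_space \<mu> by fact
  interpret nu: prob_space \<nu> by fact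
  interpret pair_prob_space \<mu> \<nu> ..
  have S: "sets ?\<pi> = sets borel"
    using sets_pair_measure_cong[OF mu(2) nu(2)] by (simp only: borel_prod)
  have sp: "space \<mu> = UNIV" "space \<nu> = UNIV"
    using mu(2) nu(2) by (auto dest: sets_eq_imp_space_eq)
  have fst_meas: "fst \<in> measurable ?\<pi> borel" and snd_meas: "snd \<in> measurable ?\<pi> borel"
    by (auto simp: measurable_cong_sets[OF S refl] intro!: borel_measurable_continuous_onI continuous_intros)
  have 1: "distr ?\<pi> borel fst = \<mu>"
  proof (rule measure_eqI)
    fix A assume "A \<in> sets (distr ?\<pi> borel fst)"
    then have A: "A \<in> sets borel" by simp
    have "fst -` A \<inter> space ?\<pi> = A \<times> space \<nu>" by (auto simp: space_pair_measure sp)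
    then show "emeasure (distr ?\<pi> borel fst) A = emeasure \<mu> A"
      using A mu(2) nu.emeasure_space_1
      by (simp add: emeasure_distr[OF fst_meas A] nu.emeasure_pair_measure_Times)
  qed (use mu(2) in simp)
  have 2: "distr ?\<pi> borel snd = \<nu>"
  proof (rule measure_eqI)
    fix A assume "A \<in> sets (distr ?\<pi> borel snd)"
    then have A: "A \<in> sets borel" by simp
    have "snd -` A \<inter> space ?\<pi> = space \<mu> \<times> A" by (auto simp: space_pair_measure sp)
    then show "emeasure (distr ?\<pi> borel snd) A = emeasure \<nu> A"
      using A nu(2) mu.emeasure_space_1
      by (simp add: emeasure_distr[OF snd_meas A] nu.emeasure_pair_measure_Times)
  qed (use nu(2) in simp)
  have "?\<pi> \<in> couplings \<mu> \<nu>"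
    using 1 2 S by (auto simp: couplings_def prob_space_axioms)
  then have "(INF \<pi>\<in>couplings \<mu> \<nu>. \<integral>\<^sup>+ z. ennreal ((norm (fst z - snd z))\<^sup>2) \<partial>\<pi>)
      \<le> (\<integral>\<^sup>+ z. ennreal ((norm (fst z - snd z))\<^sup>2) \<partial>?\<pi>)"
    by (rule INF_lower)
  also have "\<dots> \<le> (\<integral>\<^sup>+ z. ennreal (2 * (norm (fst z))\<^sup>2 + 2 * (norm (snd z))\<^sup>2) \<partial>?\<pi>)"
  proof (intro nn_integral_mono ennreal_leI)
    fix z :: "(real ^ 'd) \<times> (real ^ 'd)"
    have "(norm (fst z - snd z))\<^sup>2 \<le> (norm (fst z) + norm (snd z))\<^sup>2"
      by (intro power_mono norm_triangle_ineq4) auto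
    also have "\<dots> \<le> 2 * (norm (fst z))\<^sup>2 + 2 * (norm (snd z))\<^sup>2"
      using sum_squares_bound[of "norm (fst z)" "norm (snd z)"] by (simp add: power2_sum)
    finally show "(norm (fst z - snd z))\<^sup>2 \<le> 2 * (norm (fst z))\<^sup>2 + 2 * (norm (snd z))\<^sup>2" .
  qed
  also have "\<dots> < \<infinity>"
  proof -
    have "integrable (distr ?\<pi> borel fst) (\<lambda>z. (norm z)\<^sup>2)"
      using mu(3) by (simp only: 1)
    then have "integrable ?\<pi> (\<lambda>z. (norm (fst z))\<^sup>2)"
      by (rule integrable_distr[OF fst_meas])
    moreover have "integrable (distr ?\<pi> borel snd) (\<lambda>z. (norm z)\<^sup>2)"
      using nu(3) by (simp only: 2)
    then have "integrable ?\<pi> (\<lambda>z. (norm (snd z))\<^sup>2)"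
      by (rule integrable_distr[OF snd_meas])
    ultimately have "integrable ?\<pi> (\<lambda>z. 2 * (norm (fst z))\<^sup>2 + 2 * (norm (snd z))\<^sup>2)"
      by auto
    then show ?thesis
      by (subst nn_integral_eq_integral) auto
  qed
  finally show ?thesis .
qed

lemma finite_sampled_averages: "finite (sampled_averages t m x T)"
proof -
  have "sampled_averages t m x T \<subseteq>
      (\<lambda>y. (1 / real t) *\<^sub>R (\<Sum>r\<in>{1..t}. y r)) ` (\<Pi>\<^sub>E r\<in>{1..t}. x (T r) ` {1..m (T r)})"
  proof
    fix w assume "w \<in> sampled_averages t m x T"
    then obtain y where y: "w = (1 / real t) *\<^sub>R (\<Sum>r\<in>{1..t}. y r)"
        "\<forall>r\<in>{1..t}. y r \<in> x (T r) ` {1..m (T r)}"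
      by (auto simp: sampled_averages_def)
    show "w \<in> (\<lambda>y. (1 / real t) *\<^sub>R (\<Sum>r\<in>{1..t}. y r)) ` (\<Pi>\<^sub>E r\<in>{1..t}. x (T r) ` {1..m (T r)})"
      by (rule image_eqI[where x = "restrict y {1..t}"]) (use y in auto)
  qed
  then show ?thesis
    by (rule finite_subset) (intro finite_imageI finite_PiE, auto)
qed

lemma sampled_averages_nonempty:
  assumes "\<forall>r\<in>{1..t}. 1 \<le> m (T r)"
  shows "sampled_averages t m x T \<noteq> {}"
proof -
  have "(1 / real t) *\<^sub>R (\<Sum>r\<in>{1..t}. x (T r) 1) \<in> sampled_averages t m x T"
    unfolding sampled_averages_def using assms
    by (intro CollectI exI[where x = "\<lambda>r. x (T r) 1"]) auto
  then show ?thesis by blast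
qed

lemma support_cost_nonneg:
  assumes "finite S" "S \<noteq> {}" "\<forall>i\<in>{1..k}. 0 \<le> lam i"
  shows "0 \<le> support_cost k x lam S J"
  unfolding support_cost_def using assms
  by (subst Min_ge_iff) (auto intro!: sum_nonneg)

lemma dual_feasible_nonempty:
  assumes "finite S" "S \<noteq> {}" "\<forall>i\<in>{1..k}. 0 \<le> lam i"
  shows "dual_feasible k m x lam S \<noteq> {}"
proof -
  have "(\<lambda>_ _. 0) \<in> dual_feasible k m x lam S"
    using support_cost_nonneg[OF assms] by (simp add: dual_feasible_def)
  then show ?thesis by blast
qed

lemma dual_objective_bdd_above:
  assumes "\<forall>i\<in>{1..k}. 1 \<le> m i"
    and "\<forall>i\<in>{1..k}. \<forall>j\<in>{1..m i}. 0 \<le> p i j"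
    and "\<forall>i\<in>{1..k}. (\<Sum>j\<in>{1..m i}. p i j) = 1"
  shows "bdd_above ((\<lambda>\<gamma>. \<Sum>i\<in>{1..k}. \<Sum>j\<in>{1..m i}. p i j * \<gamma> i j) ` dual_feasible k m x lam S)"
proof (rule bdd_aboveI2)
  fix \<gamma> assume \<gamma>: "\<gamma> \<in> dual_feasible k m x lam S"
  let ?I = "\<Pi>\<^sub>E i\<in>{1..k}. {1..m i}"
  have "\<exists>J. \<forall>i\<in>{1..k}. J i \<in> {1..m i} \<and> (\<forall>j\<in>{1..m i}. \<gamma> i j \<le> \<gamma> i (J i))"
  proof (intro bchoice ballI)
    fix i assume "i \<in> {1..k}"
    then have "finite {1..m i}" "{1..m i} \<noteq> {}" using assms(1) by auto
    then have "Max (\<gamma> i ` {1..m i}) \<in> \<gamma> i ` {1..m i}" by (intro Max_in) auto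
    then obtain j where "j \<in> {1..m i}" "\<gamma> i j = Max (\<gamma> i ` {1..m i})" by auto
    then show "\<exists>j. j \<in> {1..m i} \<and> (\<forall>l\<in>{1..m i}. \<gamma> i l \<le> \<gamma> i j)"
      by (intro exI[of _ j]) auto
  qed
  then obtain J0 where J0: "\<forall>i\<in>{1..k}. J0 i \<in> {1..m i} \<and> (\<forall>j\<in>{1..m i}. \<gamma> i j \<le> \<gamma> i (J0 i))" ..
  define J where "J = restrict J0 {1..k}"
  have J: "J \<in> ?I" using J0 by (auto simp: J_def)
  have "(\<Sum>i\<in>{1..k}. \<Sum>j\<in>{1..m i}. p i j * \<gamma> i j) \<le> (\<Sum>i\<in>{1..k}. \<gamma> i (J i))"
  proof (rule sum_mono)
    fix i assume i: "i \<in> {1..k}"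
    have "(\<Sum>j\<in>{1..m i}. p i j * \<gamma> i j) \<le> (\<Sum>j\<in>{1..m i}. p i j * \<gamma> i (J i))"
      using assms(2) J0 i by (intro sum_mono mult_left_mono) (auto simp: J_def)
    also have "\<dots> = \<gamma> i (J i)"
      using assms(3) i by (simp flip: sum_distrib_right)
    finally show "(\<Sum>j\<in>{1..m i}. p i j * \<gamma> i j) \<le> \<gamma> i (J i)" .
  qed
  also have "\<dots> \<le> support_cost k x lam S J"
    using \<gamma> J by (auto simp: dual_feasible_def)
  also have "\<dots> \<le> Max (support_cost k x lam S ` ?I)"
    using J by (intro Max_ge finite_imageI finite_PiE) auto
  finally show "(\<Sum>i\<in>{1..k}. \<Sum>j\<in>{1..m i}. p i j * \<gamma> i j) \<le> Max (support_cost k x lam S ` ?I)" .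
qed

lemma integrable_dual_value_sampled_averages:
  assumes "prob_space M" and "prob_space.indep_vars M (\<lambda>_. count_space {1..k}) T {1..t}"
  shows "integrable M (\<lambda>\<omega>. dual_value k m x p lam (sampled_averages t m x (\<lambda>r. T r \<omega>)))"
proof -
  interpret prob_space M by fact
  let ?I = "\<Pi>\<^sub>E r\<in>{1..t}. {1..k}"
  let ?F = "\<lambda>\<tau>. dual_value k m x p lam (sampled_averages t m x \<tau>)"
  define R where "R = (\<lambda>\<omega>. \<lambda>r\<in>{1..t}. T r \<omega>)"
  have "R \<in> measurable M (Pi\<^sub>M {1..t} (\<lambda>_. count_space {1..k}))"
    using assms(2) unfolding R_def by (intro measurable_restrict) (auto simp: indep_vars_def2)
  then have R: "R \<in> measurable M (count_space ?I)"
    by (simp add: count_space_PiM_finite)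
  have eq: "sampled_averages t m x (\<lambda>r. T r \<omega>) = sampled_averages t m x (R \<omega>)" for \<omega>
    by (simp add: sampled_averages_def R_def)
  have "integrable M (\<lambda>\<omega>. ?F (R \<omega>))"
  proof (rule integrable_const_bound)
    have fin: "finite ?I" by (intro finite_PiE) auto
    show "AE \<omega> in M. norm (?F (R \<omega>)) \<le> Max ((\<lambda>\<tau>. norm (?F \<tau>)) ` ?I)"
      using measurable_space[OF R] fin by (intro AE_I2 Max_ge) auto
    show "(\<lambda>\<omega>. ?F (R \<omega>)) \<in> borel_measurable M"
      by (rule measurable_compose[OF R]) simp
  qed
  then show ?thesis by (simp add: eq)
qed

end

theory Submission
  imports Defs
begin

text \<open>
  For fixed atoms \<open>x i (J i)\<close>, the mean of \<open>t\<close> atoms sampled with law \<open>lam\<close> deviates from the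
  \<open>lam\<close>-centroid by \<open>1 / t\<close> of the variance in expectation, so the expected support cost of \<open>J\<close> is
  at most \<open>1 + 1 / t\<close> times the cost of \<open>J\<close> at any point \<open>w\<close>. Hence the expectation of almost optimal
  dual solutions for the sampled supports is a family of potentials that is feasible, up to this
  factor, for the unrestricted support, and weak duality bounds its objective by the barycenter value.
\<close>

section \<open>Variance decomposition and the variance of a sample mean\<close>

text \<open>Parallel axis identity: since \<open>c\<close> is the \<open>lam\<close>-mean of the
  \<open>u i\<close>, the cross terms cancel. It serves twice, with \<open>w\<close> a sampled mean
  to express its cost exactly, and with \<open>w\<close> arbitrary to bound the cost from below by
  the variance.\<close>

lemma weighted_norm_diff_centroid:
  fixes u :: "'i \<Rightarrow> 'a::real_inner"
  assumes "(\<Sum>i\<in>I. lam i) = 1"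
  defines "c \<equiv> (\<Sum>i\<in>I. lam i *\<^sub>R u i)"
  shows "(\<Sum>i\<in>I. lam i * (norm (u i - w))\<^sup>2)
    = (\<Sum>i\<in>I. lam i * (norm (u i - c))\<^sup>2) + (norm (w - c))\<^sup>2"
proof -
  have expand: "(norm (u i - w))\<^sup>2 = (norm (u i - c))\<^sup>2 + 2 * (u i \<bullet> (c - w) - c \<bullet> (c - w)) + (norm (w - c))\<^sup>2" for i
    by (simp add: power2_norm_eq_inner algebra_simps inner_commute)
  have "(\<Sum>i\<in>I. lam i * (u i \<bullet> (c - w))) = c \<bullet> (c - w)"
    by (simp add: c_def inner_sum_left)
  moreover have "(\<Sum>i\<in>I. lam i * (c \<bullet> (c - w))) = c \<bullet> (c - w)"
    using assms(1) by (simp flip: sum_distrib_right)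
  ultimately have "(\<Sum>i\<in>I. lam i * (u i \<bullet> (c - w) - c \<bullet> (c - w))) = 0"
    by (simp add: right_diff_distrib sum_subtractf)
  moreover have "(\<Sum>i\<in>I. lam i * (norm (w - c))\<^sup>2) = (norm (w - c))\<^sup>2"
    using assms(1) by (simp flip: sum_distrib_right)
  moreover have "(\<Sum>i\<in>I. lam i * (norm (u i - w))\<^sup>2) = (\<Sum>i\<in>I. lam i * (norm (u i - c))\<^sup>2)
      + 2 * (\<Sum>i\<in>I. lam i * (u i \<bullet> (c - w) - c \<bullet> (c - w))) + (\<Sum>i\<in>I. lam i * (norm (w - c))\<^sup>2)"
    unfolding expand sum_distrib_left sum.distrib[symmetric]
    by (intro sum.cong refl) (simp add: algebra_simps)
  ultimately show ?thesis by simp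
qed

text \<open>Through a finite discrete target every \<open>h\<close> is measurable and bounded.
  Functions obtained by mere choice, such as the potentials of the final proof, can therefore be
  integrated without a measurable selection.\<close>

lemma (in finite_measure) integrable_finite_range:
  fixes h :: "'b \<Rightarrow> real"
  assumes "R \<in> measurable M (count_space I)" "finite I"
  shows "integrable M (\<lambda>\<omega>. h (R \<omega>))"
proof (rule integrable_const_bound)
  show "AE \<omega> in M. norm (h (R \<omega>)) \<le> Max ((\<lambda>i. norm (h i)) ` I)"
    using measurable_space[OF assms(1)] assms(2) by (intro AE_I2 Max_ge) auto
  show "(\<lambda>\<omega>. h (R \<omega>)) \<in> borel_measurable M"
    by (rule measurable_compose[OF assms(1)]) simp
qed

lemma (in finite_measure) integral_finite_range:
  fixes h :: "'b \<Rightarrow> real"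
  assumes R: "R \<in> measurable M (count_space I)" and I: "finite I"
  shows "(\<integral>\<omega>. h (R \<omega>) \<partial>M) = (\<Sum>i\<in>I. measure M {\<omega>\<in>space M. R \<omega> = i} * h i)"
proof -
  have "(\<integral>\<omega>. h (R \<omega>) \<partial>M) = (\<integral>\<omega>. (\<Sum>i\<in>I. indicator {i} (R \<omega>) * h i) \<partial>M)"
  proof (rule Bochner_Integration.integral_cong[OF refl])
    fix \<omega> assume "\<omega> \<in> space M"
    then have "R \<omega> \<in> I" using measurable_space[OF R] by auto
    then have "(\<Sum>i\<in>I. indicator {i} (R \<omega>) * h i) = (\<Sum>i\<in>{R \<omega>}. indicator {i} (R \<omega>) * h i)"
      using I by (intro sum.mono_neutral_right) auto
    then show "h (R \<omega>) = (\<Sum>i\<in>I. indicator {i} (R \<omega>) * h i)" by simp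
  qed
  also have "\<dots> = (\<Sum>i\<in>I. (\<integral>\<omega>. indicator {i} (R \<omega>) \<partial>M) * h i)"
    using integrable_finite_range[OF R I]
    by (subst Bochner_Integration.integral_sum) auto
  also have "\<dots> = (\<Sum>i\<in>I. measure M {\<omega>\<in>space M. R \<omega> = i} * h i)"
  proof (intro sum.cong refl arg_cong2[where f = "(*)"])
    fix i
    have "(\<integral>\<omega>. indicator {i} (R \<omega>) \<partial>M) = (\<integral>\<omega>. indicator {\<omega>\<in>space M. R \<omega> = i} \<omega> \<partial>M)"
      by (rule Bochner_Integration.integral_cong) (auto simp: indicator_def)
    also have "\<dots> = measure M ({\<omega>\<in>space M. R \<omega> = i} \<inter> space M)" by simp
    also have "{\<omega>\<in>space M. R \<omega> = i} \<inter> space M = {\<omega>\<in>space M. R \<omega> = i}" by auto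
    finally show "(\<integral>\<omega>. indicator {i} (R \<omega>) \<partial>M) = measure M {\<omega>\<in>space M. R \<omega> = i}" .
  qed
  finally show ?thesis .
qed

text \<open>Expand the squared norm of the sum of centred vectors: each of the \<open>t\<close>
  diagonal terms has mean \<open>V\<close>, the others have mean 0 by independence, and the
  prefactor is \<open>1 / t^2\<close>.\<close>

lemma (in prob_space) expectation_norm_sample_mean_diff:
  fixes u :: "'i \<Rightarrow> 'c::euclidean_space"
  assumes I: "finite I" "(\<Sum>i\<in>I. lam i) = 1" and t: "1 \<le> t"
    and indep: "indep_vars (\<lambda>_. count_space I) T {1..t}"
    and law: "\<forall>r\<in>{1..t}. \<forall>i\<in>I. prob {\<omega>\<in>space M. T r \<omega> = i} = lam i"
  defines "c \<equiv> (\<Sum>i\<in>I. lam i *\<^sub>R u i)"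
  shows "expectation (\<lambda>\<omega>. (norm ((1 / real t) *\<^sub>R (\<Sum>r\<in>{1..t}. u (T r \<omega>)) - c))\<^sup>2)
    = (\<Sum>i\<in>I. lam i * (norm (u i - c))\<^sup>2) / real t"
proof -
  define a where "a i = u i - c" for i
  define V where "V = (\<Sum>i\<in>I. lam i * (norm (a i))\<^sup>2)"
  have meas: "T r \<in> measurable M (count_space I)" if "r \<in> {1..t}" for r
    using indep that by (auto simp: indep_vars_def2)
  have E: "expectation (\<lambda>\<omega>. h (T r \<omega>)) = (\<Sum>i\<in>I. lam i * h i)" if "r \<in> {1..t}" for r and h :: "'i \<Rightarrow> real"
    unfolding integral_finite_range[OF meas[OF that] I(1)] using law that by simp
  have int1: "integrable M (\<lambda>\<omega>. h (T r \<omega>))" if "r \<in> {1..t}" for r and h :: "'i \<Rightarrow> real"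
    by (rule integrable_finite_range[OF meas[OF that] I(1)])
  have centred: "(\<Sum>i\<in>I. lam i * (a i \<bullet> b)) = 0" for b
  proof -
    have "(\<Sum>i\<in>I. lam i * (a i \<bullet> b)) = (\<Sum>i\<in>I. lam i * (u i \<bullet> b)) - (\<Sum>i\<in>I. lam i) * (c \<bullet> b)"
      by (simp add: a_def inner_diff_left right_diff_distrib sum_subtractf sum_distrib_right)
    also have "\<dots> = 0" using I(2) by (simp add: c_def inner_sum_left)
    finally show ?thesis .
  qed
  have cross: "integrable M (\<lambda>\<omega>. a (T r \<omega>) \<bullet> a (T s \<omega>)) \<and>
      expectation (\<lambda>\<omega>. a (T r \<omega>) \<bullet> a (T s \<omega>)) = (if r = s then V else 0)"
    if rs: "r \<in> {1..t}" "s \<in> {1..t}" for r s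
  proof (cases "r = s")
    case True
    then show ?thesis using E[OF rs(1), of "\<lambda>i. a i \<bullet> a i"] int1[OF rs(1), of "\<lambda>i. a i \<bullet> a i"]
      by (simp add: V_def power2_norm_eq_inner)
  next
    case False
    \<comment> \<open>Independence factorises expectations of products of scalars, so the inner
      product is split along the basis vectors \<open>b\<close>; each factor has mean 0 by
      \<open>centred\<close>.\<close>
    have coord: "integrable M (\<lambda>\<omega>. (a (T r \<omega>) \<bullet> b) * (a (T s \<omega>) \<bullet> b)) \<and>
        expectation (\<lambda>\<omega>. (a (T r \<omega>) \<bullet> b) * (a (T s \<omega>) \<bullet> b)) = 0" for b
    proof -
      have ind: "indep_vars (\<lambda>_. borel) (\<lambda>q \<omega>. a (T q \<omega>) \<bullet> b) {r, s}"
        by (rule indep_vars_compose2[OF indep_vars_subset[OF indep], where Y = "\<lambda>_ i. a i \<bullet> b"])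
           (use rs in auto)
      have "integrable M (\<lambda>\<omega>. a (T q \<omega>) \<bullet> b)" if "q \<in> {r, s}" for q
        using int1[of q "\<lambda>i. a i \<bullet> b"] that rs by auto
      from indep_vars_integrable[OF _ ind this] indep_vars_lebesgue_integral[OF _ ind this]
      show ?thesis
        using False E[OF rs(1), of "\<lambda>i. a i \<bullet> b"] centred by simp
    qed
    have "(\<lambda>\<omega>. a (T r \<omega>) \<bullet> a (T s \<omega>)) = (\<lambda>\<omega>. \<Sum>b\<in>Basis. (a (T r \<omega>) \<bullet> b) * (a (T s \<omega>) \<bullet> b))"
      by (rule ext) (rule euclidean_inner)
    then show ?thesis using False coord by simp
  qed
  have "(norm ((1 / real t) *\<^sub>R (\<Sum>r\<in>{1..t}. u (T r \<omega>)) - c))\<^sup>2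
      = (\<Sum>r\<in>{1..t}. \<Sum>s\<in>{1..t}. a (T r \<omega>) \<bullet> a (T s \<omega>)) / (real t)\<^sup>2" for \<omega>
  proof -
    have "(1 / real t) *\<^sub>R (\<Sum>r\<in>{1..t}. u (T r \<omega>)) - c = (1 / real t) *\<^sub>R (\<Sum>r\<in>{1..t}. a (T r \<omega>))"
      using t by (simp add: a_def sum_subtractf scaleR_diff_right sum_constant_scaleR)
    then show ?thesis
      by (simp add: power_mult_distrib power_divide power2_norm_eq_inner inner_sum_left inner_sum_right)
         (simp add: inner_commute power2_eq_square)
  qed
  then have "expectation (\<lambda>\<omega>. (norm ((1 / real t) *\<^sub>R (\<Sum>r\<in>{1..t}. u (T r \<omega>)) - c))\<^sup>2)
      = (\<Sum>r\<in>{1..t}. \<Sum>s\<in>{1..t}. expectation (\<lambda>\<omega>. a (T r \<omega>) \<bullet> a (T s \<omega>))) / (real t)\<^sup>2"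
    using cross
    by (simp only: integral_divide_zero, subst Bochner_Integration.integral_sum)
       (auto simp: Bochner_Integration.integral_sum intro!: Bochner_Integration.integrable_sum)
  also have "(\<Sum>r\<in>{1..t}. \<Sum>s\<in>{1..t}. expectation (\<lambda>\<omega>. a (T r \<omega>) \<bullet> a (T s \<omega>)))
      = (\<Sum>r\<in>{1..t}. \<Sum>s\<in>{1..t}. if r = s then V else 0)"
    using cross by (intro sum.cong refl) blast
  also have "\<dots> = real t * V" by simp
  finally show ?thesis using t by (simp add: V_def a_def power2_eq_square)
qed

section \<open>Expected support cost of the sampled averages\<close>

lemma support_cost_le:
  assumes "finite S" "w \<in> S"
  shows "support_cost k x lam S J \<le> (\<Sum>i\<in>{1..k}. lam i * (norm (x i (J i) - w))\<^sup>2)"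
  unfolding support_cost_def using assms by (intro Min_le) auto

lemma (in prob_space) measurable_sample_tuple:
  assumes "indep_vars (\<lambda>_. count_space {1..k::nat}) T {1..t::nat}"
  shows "(\<lambda>\<omega>. \<lambda>r\<in>{1..t}. T r \<omega>) \<in> measurable M (count_space (\<Pi>\<^sub>E r\<in>{1..t}. {1..k}))"
proof -
  have "(\<lambda>\<omega>. \<lambda>r\<in>{1..t}. T r \<omega>) \<in> measurable M (Pi\<^sub>M {1..t} (\<lambda>_. count_space {1..k}))"
    using assms by (intro measurable_restrict) (auto simp: indep_vars_def2)
  then show ?thesis by (simp add: count_space_PiM_finite)
qed

lemma sampled_averages_restrict:
  "sampled_averages t m x (restrict \<tau> {1..t}) = sampled_averages t m x \<tau>"
  by (simp add: sampled_averages_def)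

text \<open>The minimum over the support is at most the cost at the single random point
  \<open>avg\<close>, namely \<open>V\<close> plus the squared deviation of \<open>avg\<close> from
  \<open>c\<close>. That deviation has mean \<open>V / t\<close>, and \<open>V\<close> is the least
  cost over all \<open>w\<close>.\<close>

lemma (in prob_space) expectation_support_cost_sampled_averages:
  fixes x :: "nat \<Rightarrow> nat \<Rightarrow> real ^ 'd"
  assumes lam: "(\<Sum>i\<in>{1..k}. lam i) = 1" and t: "1 \<le> t"
    and indep: "indep_vars (\<lambda>_. count_space {1..k}) T {1..t}"
    and law: "\<forall>r\<in>{1..t}. \<forall>i\<in>{1..k}. prob {\<omega>\<in>space M. T r \<omega> = i} = lam i"
    and J: "J \<in> (\<Pi>\<^sub>E i\<in>{1..k}. {1..m i})"
  shows "expectation (\<lambda>\<omega>. support_cost k x lam (sampled_averages t m x (\<lambda>r. T r \<omega>)) J)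
    \<le> (1 + 1 / real t) * (\<Sum>i\<in>{1..k}. lam i * (norm (x i (J i) - w))\<^sup>2)"
proof -
  define u where "u i = x i (J i)" for i
  define c where "c = (\<Sum>i\<in>{1..k}. lam i *\<^sub>R u i)"
  define V where "V = (\<Sum>i\<in>{1..k}. lam i * (norm (u i - c))\<^sup>2)"
  define R where "R \<omega> = (\<lambda>r\<in>{1..t}. T r \<omega>)" for \<omega>
  define avg where "avg \<tau> = (1 / real t) *\<^sub>R (\<Sum>r\<in>{1..t}. u (\<tau> r))" for \<tau>
  note int = integrable_finite_range[OF measurable_sample_tuple[OF indep], folded R_def]
  have fin: "finite (\<Pi>\<^sub>E r\<in>{1..t}. {1..k})" by (intro finite_PiE) auto
  have avg_R: "avg (R \<omega>) = (1 / real t) *\<^sub>R (\<Sum>r\<in>{1..t}. u (T r \<omega>))" for \<omega>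
    by (simp add: avg_def R_def)
  have T_range: "T r \<omega> \<in> {1..k}" if "\<omega> \<in> space M" "r \<in> {1..t}" for \<omega> r
    using indep that measurable_space[of "T r" M "count_space {1..k}" \<omega>]
    by (auto simp: indep_vars_def2)
  have "expectation (\<lambda>\<omega>. support_cost k x lam (sampled_averages t m x (R \<omega>)) J)
      \<le> expectation (\<lambda>\<omega>. V + (norm (avg (R \<omega>) - c))\<^sup>2)"
  proof (rule integral_mono)
    fix \<omega> assume \<omega>: "\<omega> \<in> space M"
    \<comment> \<open>\<open>J\<close> is fixed before sampling, so positions that draw the same
      index use the same atom. The support also contains mixed choices, but this choice suffices for
      the bound.\<close>
    have "avg (R \<omega>) \<in> sampled_averages t m x (R \<omega>)"
      unfolding sampled_averages_def avg_def using J T_range[OF \<omega>]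
      by (intro CollectI exI[where x = "\<lambda>r. u (R \<omega> r)"])
         (auto simp: u_def R_def PiE_iff)
    from support_cost_le[OF finite_sampled_averages this, of k x lam J]
    show "support_cost k x lam (sampled_averages t m x (R \<omega>)) J \<le> V + (norm (avg (R \<omega>) - c))\<^sup>2"
      using weighted_norm_diff_centroid[OF lam, of u "avg (R \<omega>)"]
      unfolding V_def c_def u_def by linarith
  qed (use fin in \<open>auto intro!: int[where h = "\<lambda>\<tau>. support_cost k x lam (sampled_averages t m x \<tau>) J"]
        Bochner_Integration.integrable_add int[where h = "\<lambda>\<tau>. (norm (avg \<tau> - c))\<^sup>2"]\<close>)
  also have "\<dots> = V + expectation (\<lambda>\<omega>. (norm (avg (R \<omega>) - c))\<^sup>2)"
    using int[where h = "\<lambda>\<tau>. (norm (avg \<tau> - c))\<^sup>2"] fin by (simp add: prob_space)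
  also have "expectation (\<lambda>\<omega>. (norm (avg (R \<omega>) - c))\<^sup>2) = V / real t"
    unfolding avg_R V_def c_def
    by (rule expectation_norm_sample_mean_diff[OF _ lam t indep law]) simp
  also have "V + V / real t = (1 + 1 / real t) * V" by (simp add: algebra_simps)
  also have "\<dots> \<le> (1 + 1 / real t) * (\<Sum>i\<in>{1..k}. lam i * (norm (x i (J i) - w))\<^sup>2)"
    using weighted_norm_diff_centroid[OF lam, of u w]
    by (intro mult_left_mono) (auto simp: V_def c_def u_def)
  finally show ?thesis by (simp only: R_def sampled_averages_restrict)
qed

section \<open>Weak Kantorovich duality\<close>

text \<open>Integrating the pointwise inequality against a coupling recovers both integrals from its
  marginals; then pass to the infimum. The value \<open>c = 0\<close> is allowed because weights may
  vanish, and the inequality is asked only for almost every \<open>z\<close> because potentials for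
  an atomic measure are controlled only on its atoms.\<close>

lemma W2_weak_duality:
  fixes \<mu> \<nu> :: "(real ^ 'd) measure"
  assumes \<mu>: "\<mu> \<in> finite_second_moment_measures" and \<nu>: "\<nu> \<in> finite_second_moment_measures"
    and f: "integrable \<mu> f" and g: "integrable \<nu> g" and c: "0 \<le> c"
    and le: "AE z in \<nu>. \<forall>w. f w + g z \<le> c * (norm (w - z))\<^sup>2"
  shows "integral\<^sup>L \<mu> f + integral\<^sup>L \<nu> g \<le> c * (W2 \<mu> \<nu>)\<^sup>2"
proof -
  define cost where "cost \<pi> = (\<integral>\<^sup>+ z. ennreal ((norm (fst z - snd z))\<^sup>2) \<partial>\<pi>)"
    for \<pi> :: "((real ^ 'd) \<times> (real ^ 'd)) measure"
  define a where "a = integral\<^sup>L \<mu> f + integral\<^sup>L \<nu> g"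
  have bound: "ennreal a \<le> ennreal c * cost \<pi>" if "\<pi> \<in> couplings \<mu> \<nu>" for \<pi>
  proof -
    have S: "sets \<pi> = sets borel" and d: "distr \<pi> borel fst = \<mu>" "distr \<pi> borel snd = \<nu>"
      using that by (auto simp: couplings_def)
    have m: "fst \<in> measurable \<pi> borel" "snd \<in> measurable \<pi> borel"
      by (auto simp: measurable_cong_sets[OF S refl] intro!: borel_measurable_continuous_onI continuous_intros)
    have i: "integrable \<pi> (\<lambda>z. f (fst z))" "integrable \<pi> (\<lambda>z. g (snd z))"
      using integrable_distr[OF m(1), of f] integrable_distr[OF m(2), of g] f g d by auto
    have fm: "f \<in> borel_measurable borel" "g \<in> borel_measurable borel"
      using borel_measurable_integrable[OF f] borel_measurable_integrable[OF g] \<mu> \<nu>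
      by (auto simp: finite_second_moment_measures_def cong: measurable_cong_sets)
    have "a = (\<integral>z. f (fst z) + g (snd z) \<partial>\<pi>)"
      using integral_distr[OF m(1) fm(1)] integral_distr[OF m(2) fm(2)] i d by (simp add: a_def)
    \<comment> \<open>Taking the positive part turns the real integral into an
      \<open>ennreal\<close> one, comparable with \<open>cost \<pi>\<close> even if the latter is
      infinite.\<close>
    also have "\<dots> \<le> (\<integral>z. max 0 (f (fst z) + g (snd z)) \<partial>\<pi>)"
      using i by (intro integral_mono) auto
    finally have "ennreal a \<le> ennreal (\<integral>z. max 0 (f (fst z) + g (snd z)) \<partial>\<pi>)"
      by (rule ennreal_leI)
    also have "\<dots> = (\<integral>\<^sup>+z. ennreal (max 0 (f (fst z) + g (snd z))) \<partial>\<pi>)"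
      using i by (intro nn_integral_eq_integral[symmetric]) auto
    also have "\<dots> \<le> (\<integral>\<^sup>+z. ennreal c * ennreal ((norm (fst z - snd z))\<^sup>2) \<partial>\<pi>)"
    proof (rule nn_integral_mono_AE)
      have "AE z in \<pi>. \<forall>w. f w + g (snd z) \<le> c * (norm (w - snd z))\<^sup>2"
        by (rule AE_distrD[OF m(2)], unfold d) (rule le)
      then show "AE z in \<pi>. ennreal (max 0 (f (fst z) + g (snd z))) \<le> ennreal c * ennreal ((norm (fst z - snd z))\<^sup>2)"
        by eventually_elim (use c in \<open>auto simp flip: ennreal_mult intro!: ennreal_leI\<close>)
    qed
    also have "\<dots> = ennreal c * cost \<pi>"
      unfolding cost_def
      by (rule nn_integral_cmult)
         (auto simp: measurable_cong_sets[OF S refl] intro!: measurable_compose[OF _ measurable_ennreal]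
           borel_measurable_continuous_onI continuous_intros)
    finally show ?thesis .
  qed
  let ?I = "INF \<pi>\<in>couplings \<mu> \<nu>. cost \<pi>"
  have fin: "?I < \<infinity>" using transport_cost_finite[OF \<mu> \<nu>] by (simp add: cost_def)
  have W: "(W2 \<mu> \<nu>)\<^sup>2 = enn2real ?I" by (simp add: W2_def cost_def)
  have "a \<le> c * enn2real ?I"
  proof (cases "c = 0")
    case True
    \<comment> \<open>An infimum over the empty set would be infinite, so finiteness yields a
      coupling, whose bound reads \<open>a \<le> 0\<close> when \<open>c = 0\<close>.\<close>
    have "couplings \<mu> \<nu> \<noteq> {}" using fin by auto
    then obtain \<pi> where "\<pi> \<in> couplings \<mu> \<nu>" by blast
    from bound[OF this] True have "ennreal a \<le> 0" by simp
    then show ?thesis using True by (simp add: ennreal_eq_0_iff)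
  next
    case False
    then have c: "c > 0" using assms(5) by simp
    have "ennreal (a / c) \<le> ?I"
    proof (rule INF_greatest)
      fix \<pi> assume "\<pi> \<in> couplings \<mu> \<nu>"
      from bound[OF this] show "ennreal (a / c) \<le> cost \<pi>"
        by (cases "cost \<pi>")
           (use c in \<open>auto simp flip: ennreal_mult simp: ennreal_le_iff pos_divide_le_eq mult.commute\<close>)
    qed
    then have "enn2real (ennreal (a / c)) \<le> enn2real ?I"
      using fin by (intro enn2real_mono) auto
    \<comment> \<open>Only an inequality holds, as \<open>ennreal\<close> sends negative reals to
      0.\<close>
    moreover have "a / c \<le> enn2real (ennreal (a / c))"
      by (cases "a / c \<ge> 0") (auto simp: enn2real_ennreal ennreal_neg)
    ultimately have "a / c \<le> enn2real ?I" by linarith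
    then show ?thesis using c by (simp add: pos_divide_le_eq mult.commute)
  qed
  then show ?thesis by (simp add: W a_def)
qed

section \<open>Potentials for atomic measures and lower bounds on the barycenter value\<close>

lemma integral_atomic_measure:
  fixes g :: "real ^ 'd \<Rightarrow> real"
  assumes p: "\<forall>j\<in>{1..m i}. 0 \<le> p i j" and [measurable]: "g \<in> borel_measurable borel"
  shows "integrable (atomic_measure m x p i) g"
    and "integral\<^sup>L (atomic_measure m x p i) g = (\<Sum>j\<in>{1..m i}. p i j * g (x i j))"
proof -
  have x: "x i \<in> measurable (point_measure {1..m i} (\<lambda>j. ennreal (p i j))) borel"
    by (auto simp: point_measure_def)
  show "integrable (atomic_measure m x p i) g"
    unfolding atomic_measure_def
    by (subst integrable_distr_eq[OF x]) (auto intro: integrable_point_measure_finite)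
  show "integral\<^sup>L (atomic_measure m x p i) g = (\<Sum>j\<in>{1..m i}. p i j * g (x i j))"
    unfolding atomic_measure_def using p
    by (subst integral_distr[OF x], simp, subst lebesgue_integral_point_measure_finite) auto
qed

lemma AE_atomic_measure:
  fixes x :: "nat \<Rightarrow> nat \<Rightarrow> real ^ 'd"
  shows "AE z in atomic_measure m x p i. z \<in> x i ` {1..m i}"
proof (rule AE_I)
  show "{z \<in> space (atomic_measure m x p i). z \<notin> x i ` {1..m i}} \<subseteq> - x i ` {1..m i}" by auto
  have "- x i ` {1..m i} \<in> sets borel"
    by (intro borel_open open_Compl finite_imp_closed) auto
  then show "- x i ` {1..m i} \<in> sets (atomic_measure m x p i)"
    and "emeasure (atomic_measure m x p i) (- x i ` {1..m i}) = 0"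
    by (simp_all add: emeasure_atomic_measure) (simp add: atomic_measure_def)
qed

lemma W2_atomic_measure_weak_duality:
  fixes x :: "nat \<Rightarrow> nat \<Rightarrow> real ^ 'd"
  assumes \<mu>: "\<mu> \<in> finite_second_moment_measures"
    and p: "\<forall>j\<in>{1..m i}. 0 \<le> p i j" "(\<Sum>j\<in>{1..m i}. p i j) = 1"
    and inj: "inj_on (x i) {1..m i}"
    and f: "integrable \<mu> f" and c: "0 \<le> c"
    and le: "\<And>w j. j \<in> {1..m i} \<Longrightarrow> f w + \<gamma> j \<le> c * (norm (x i j - w))\<^sup>2"
  shows "integral\<^sup>L \<mu> f + (\<Sum>j\<in>{1..m i}. p i j * \<gamma> j) \<le> c * (W2 \<mu> (atomic_measure m x p i))\<^sup>2"
proof -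
  \<comment> \<open>Extends \<open>\<gamma>\<close> by 0 off the atoms; distinctness of the atoms
    gives \<open>g\<close> the value \<open>\<gamma> j\<close> at \<open>x i j\<close>. Elsewhere
    the dual inequality may fail, but those points form a null set.\<close>
  define g where "g z = (\<Sum>l\<in>{1..m i}. \<gamma> l * indicator {x i l} z)" for z
  have [measurable]: "g \<in> borel_measurable borel" unfolding g_def by measurable
  have g: "g (x i j) = \<gamma> j" if "j \<in> {1..m i}" for j
  proof -
    have "g (x i j) = (\<Sum>l\<in>{j}. \<gamma> l * indicator {x i l} (x i j))"
      unfolding g_def using that inj by (intro sum.mono_neutral_right) (auto simp: indicator_def dest: inj_onD)
    then show ?thesis by simp
  qed
  have "integral\<^sup>L \<mu> f + integral\<^sup>L (atomic_measure m x p i) g \<le> c * (W2 \<mu> (atomic_measure m x p i))\<^sup>2"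
  proof (rule W2_weak_duality[OF \<mu> _ f _ c])
    show "atomic_measure m x p i \<in> finite_second_moment_measures"
      using p by (rule atomic_measure_in_finite_second_moment_measures)
    show "integrable (atomic_measure m x p i) g"
      using p(1) by (rule integral_atomic_measure) simp
    show "AE z in atomic_measure m x p i. \<forall>w. f w + g z \<le> c * (norm (w - z))\<^sup>2"
      using AE_atomic_measure
      by eventually_elim (use le g in \<open>auto simp: norm_minus_commute\<close>)
  qed
  then show ?thesis
    using g integral_atomic_measure(2)[of m i p g x] p(1) by simp
qed

text \<open>
  This bypasses gluing the couplings of \<open>\<mu>\<close> with the individual measures: the potentials \<open>\<gamma> i\<close> have
  transforms \<open>f i w = (MIN j. c * lam i * |x i j - w|\<^sup>2 - \<gamma> i j)\<close>, whose sum over \<open>i\<close> is nonnegative.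
\<close>

lemma dual_objective_le_barycenter_value:
  fixes x :: "nat \<Rightarrow> nat \<Rightarrow> real ^ 'd"
  assumes k: "1 \<le> k" and m: "\<forall>i\<in>{1..k}. 1 \<le> m i"
    and inj: "\<forall>i\<in>{1..k}. inj_on (x i) {1..m i}"
    and p: "\<forall>i\<in>{1..k}. \<forall>j\<in>{1..m i}. 0 \<le> p i j" "\<forall>i\<in>{1..k}. (\<Sum>j\<in>{1..m i}. p i j) = 1"
    and lam: "\<forall>i\<in>{1..k}. 0 \<le> lam i" and c: "0 < c"
    and le: "\<And>J w. J \<in> (\<Pi>\<^sub>E i\<in>{1..k}. {1..m i}) \<Longrightarrow>
      (\<Sum>i\<in>{1..k}. \<gamma> i (J i)) \<le> c * (\<Sum>i\<in>{1..k}. lam i * (norm (x i (J i) - w))\<^sup>2)"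
  shows "(\<Sum>i\<in>{1..k}. \<Sum>j\<in>{1..m i}. p i j * \<gamma> i j) \<le> c * barycenter_value k m x p lam"
proof -
  define D where "D = (\<Sum>i\<in>{1..k}. \<Sum>j\<in>{1..m i}. p i j * \<gamma> i j)"
  have "D / c \<le> barycenter_value k m x p lam"
    unfolding barycenter_value_def
  proof (rule cINF_greatest)
    show "finite_second_moment_measures \<noteq> ({} :: (real ^ 'd) measure set)"
      \<comment> \<open>The first of the given measures, available since \<open>1 \<le> k\<close>,
        witnesses that the real infimum ranges over a nonempty set.\<close>
      using atomic_measure_in_finite_second_moment_measures[of m 1 p x] k p by auto
    fix \<mu> :: "(real ^ 'd) measure" assume \<mu>: "\<mu> \<in> finite_second_moment_measures"
    then interpret prob_space \<mu> by (simp add: finite_second_moment_measures_def)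
    have S: "sets \<mu> = sets borel" and sq: "integrable \<mu> (\<lambda>z. (norm z)\<^sup>2)"
      using \<mu> by (auto simp: finite_second_moment_measures_def)
    define q where "q i j w = c * lam i * (norm (x i j - w))\<^sup>2 - \<gamma> i j" for i j w
    define f where "f i w = (MIN j\<in>{1..m i}. q i j w)" for i w
    \<comment> \<open>The finite second moment of \<open>\<mu>\<close> makes every
      \<open>q i j\<close> integrable, hence also the finite minima \<open>f i\<close>.\<close>
    have "integrable \<mu> (\<lambda>w. (norm (v - w))\<^sup>2)" for v
    proof (rule Bochner_Integration.integrable_bound)
      show "integrable \<mu> (\<lambda>w. 2 * (norm v)\<^sup>2 + 2 * (norm w)\<^sup>2)" using sq by simp
      show "(\<lambda>w. (norm (v - w))\<^sup>2) \<in> borel_measurable \<mu>"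
        by (auto simp: measurable_cong_sets[OF S refl] intro!: borel_measurable_continuous_onI continuous_intros)
      have "(norm (v - w))\<^sup>2 \<le> 2 * (norm v)\<^sup>2 + 2 * (norm w)\<^sup>2" for w
      proof -
        have "(norm (v - w))\<^sup>2 \<le> (norm v + norm w)\<^sup>2"
          by (intro power_mono norm_triangle_ineq4) auto
        also have "\<dots> \<le> 2 * (norm v)\<^sup>2 + 2 * (norm w)\<^sup>2"
          using sum_squares_bound[of "norm v" "norm w"] by (simp add: power2_sum)
        finally show ?thesis .
      qed
      then show "AE w in \<mu>. norm ((norm (v - w))\<^sup>2) \<le> norm (2 * (norm v)\<^sup>2 + 2 * (norm w)\<^sup>2)"
        by (intro AE_I2) simp
    qed
    then have f_int: "integrable \<mu> (f i)" if "i \<in> {1..k}" for i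
      unfolding f_def q_def using m that
      by (intro integrable_MIN Bochner_Integration.integrable_diff integrable_mult_right) auto
    have f_le: "f i w + \<gamma> i j \<le> (c * lam i) * (norm (x i j - w))\<^sup>2" if "j \<in> {1..m i}" for i j w
    proof -
      have "f i w \<le> q i j w" unfolding f_def using that by (intro Min_le) auto
      then show ?thesis by (simp add: q_def)
    qed
    \<comment> \<open>At a given \<open>w\<close> the minima for different \<open>i\<close> are
      attained separately, so the minimising indices assemble into one tuple \<open>J\<close>, to
      which \<open>le\<close> applies at this same \<open>w\<close>.\<close>
    have f_sum: "0 \<le> (\<Sum>i\<in>{1..k}. f i w)" for w
    proof -
      have "\<forall>i\<in>{1..k}. \<exists>j. j \<in> {1..m i} \<and> f i w = q i j w"
      proof
        fix i assume "i \<in> {1..k}"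
        then have "f i w \<in> (\<lambda>j. q i j w) ` {1..m i}"
          unfolding f_def using m by (intro Min_in) auto
        then show "\<exists>j. j \<in> {1..m i} \<and> f i w = q i j w" by auto
      qed
      then obtain J0 where J0: "\<forall>i\<in>{1..k}. J0 i \<in> {1..m i} \<and> f i w = q i (J0 i) w"
        by metis
      define J where "J = restrict J0 {1..k}"
      have "(\<Sum>i\<in>{1..k}. f i w) = (\<Sum>i\<in>{1..k}. q i (J i) w)"
        using J0 by (intro sum.cong) (auto simp: J_def)
      also have "\<dots> = c * (\<Sum>i\<in>{1..k}. lam i * (norm (x i (J i) - w))\<^sup>2) - (\<Sum>i\<in>{1..k}. \<gamma> i (J i))"
        by (simp add: q_def sum_subtractf sum_distrib_left mult.assoc)
      also have "\<dots> \<ge> 0" using le[of J w] J0 by (auto simp: J_def PiE_iff)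
      finally show ?thesis .
    qed
    have "0 \<le> (\<integral>w. (\<Sum>i\<in>{1..k}. f i w) \<partial>\<mu>)"
      using f_sum by (intro integral_nonneg_AE AE_I2)
    also have "\<dots> = (\<Sum>i\<in>{1..k}. integral\<^sup>L \<mu> (f i))"
      using f_int by (intro Bochner_Integration.integral_sum)
    \<comment> \<open>Adding the nonnegative sum of the integrals to \<open>D\<close> gives each
      \<open>i\<close> a pair of potentials for weak duality with constant
      \<open>c * lam i\<close>.\<close>
    finally have "D \<le> (\<Sum>i\<in>{1..k}. integral\<^sup>L \<mu> (f i) + (\<Sum>j\<in>{1..m i}. p i j * \<gamma> i j))"
      by (simp add: D_def sum.distrib)
    also have "\<dots> \<le> (\<Sum>i\<in>{1..k}. (c * lam i) * (W2 \<mu> (atomic_measure m x p i))\<^sup>2)"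
    proof (rule sum_mono)
      fix i assume i: "i \<in> {1..k}"
      show "integral\<^sup>L \<mu> (f i) + (\<Sum>j\<in>{1..m i}. p i j * \<gamma> i j)
          \<le> (c * lam i) * (W2 \<mu> (atomic_measure m x p i))\<^sup>2"
        using i p inj lam c f_int f_le
        by (intro W2_atomic_measure_weak_duality[OF \<mu>]) auto
    qed
    also have "\<dots> = (\<Sum>i\<in>{1..k}. lam i * (W2 \<mu> (atomic_measure m x p i))\<^sup>2) * c"
      by (simp add: sum_distrib_left sum_distrib_right mult_ac)
    finally show "D / c \<le> (\<Sum>i\<in>{1..k}. lam i * (W2 \<mu> (atomic_measure m x p i))\<^sup>2)"
      using c by (simp add: pos_divide_le_eq)
  qed
  then show ?thesis using c by (simp add: D_def pos_divide_le_eq mult.commute)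
qed

section \<open>Averaging almost optimal dual solutions over the sample\<close>

theorem theorem2:
  fixes k n t :: nat
    and m :: "nat \<Rightarrow> nat"
    and x :: "nat \<Rightarrow> nat \<Rightarrow> real ^ 'd"
    and p :: "nat \<Rightarrow> nat \<Rightarrow> real"
    and lam :: "nat \<Rightarrow> real"
    and M :: "'w measure"
    and T :: "nat \<Rightarrow> 'w \<Rightarrow> nat"
  assumes support_size: "\<forall>i\<in>{1..k}. 1 \<le> m i \<and> m i \<le> n"
    and distinct_atoms: "\<forall>i\<in>{1..k}. inj_on (x i) {1..m i}"
    and p_nonneg: "\<forall>i\<in>{1..k}. \<forall>j\<in>{1..m i}. 0 \<le> p i j"
    and p_sum: "\<forall>i\<in>{1..k}. (\<Sum>j\<in>{1..m i}. p i j) = 1"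
    and lam_nonneg: "\<forall>i\<in>{1..k}. 0 \<le> lam i"
    and lam_sum: "(\<Sum>i\<in>{1..k}. lam i) = 1"
    and t_range: "t \<in> {1..k}"
    and M_prob: "prob_space M"
    and T_indep: "prob_space.indep_vars M (\<lambda>_. count_space {1..k}) T {1..t}"
    and T_law: "\<forall>r\<in>{1..t}. \<forall>i\<in>{1..k}. measure M {\<omega> \<in> space M. T r \<omega> = i} = lam i"
  shows "integral\<^sup>L M (\<lambda>\<omega>. dual_value k m x p lam (sampled_averages t m x (\<lambda>r. T r \<omega>)))
           \<le> (1 + 1 / real t) * barycenter_value k m x p lam"
\<comment> \<open>\<open>dual_value\<close> is a supremum whose attainment is not established, so
  solutions within \<open>e\<close> of it are used.\<close>
proof (rule field_le_epsilon)
  fix e :: real assume e: "0 < e"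
  interpret prob_space M by (rule M_prob)
  let ?I = "\<Pi>\<^sub>E r\<in>{1..t}. {1..k}"
  \<comment> \<open>Restricting the draws to positions \<open>1..t\<close> leaves finitely many
    possible tuples; a dual solution is chosen per tuple, not per \<open>\<omega>\<close>.\<close>
  define R where "R \<omega> = (\<lambda>r\<in>{1..t}. T r \<omega>)" for \<omega>
  define obj where "obj \<gamma> = (\<Sum>i\<in>{1..k}. \<Sum>j\<in>{1..m i}. p i j * \<gamma> i j)" for \<gamma> :: "nat \<Rightarrow> nat \<Rightarrow> real"
  let ?S = "sampled_averages t m x"
  have R: "R \<in> measurable M (count_space ?I)"
    unfolding R_def by (rule measurable_sample_tuple[OF T_indep])
  have fin: "finite ?I" by (intro finite_PiE) auto
  note int = integrable_finite_range[OF R fin]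
  have "\<exists>\<gamma>. \<gamma> \<in> dual_feasible k m x lam (?S \<tau>) \<and> dual_value k m x p lam (?S \<tau>) - e < obj \<gamma>"
    if "\<tau> \<in> ?I" for \<tau>
  proof -
    have "dual_feasible k m x lam (?S \<tau>) \<noteq> {}"
      using that support_size lam_nonneg
      by (intro dual_feasible_nonempty finite_sampled_averages sampled_averages_nonempty) (auto simp: PiE_iff)
    moreover have "bdd_above (obj ` dual_feasible k m x lam (?S \<tau>))"
      unfolding obj_def using support_size p_nonneg p_sum by (intro dual_objective_bdd_above) auto
    ultimately show ?thesis
      using less_cSUP_iff[of "dual_feasible k m x lam (?S \<tau>)" obj "dual_value k m x p lam (?S \<tau>) - e"] e
      by (auto simp: dual_value_def obj_def)
  qed
  then obtain \<gamma> where feas: "\<And>\<tau>. \<tau> \<in> ?I \<Longrightarrow> \<gamma> \<tau> \<in> dual_feasible k m x lam (?S \<tau>)"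
    and opt: "\<And>\<tau>. \<tau> \<in> ?I \<Longrightarrow> dual_value k m x p lam (?S \<tau>) - e < obj (\<gamma> \<tau>)"
    by metis
  have RI: "R \<omega> \<in> ?I" if "\<omega> \<in> space M" for \<omega>
    using measurable_space[OF R that] by simp
  \<comment> \<open>Objective and constraints are linear in the potentials: \<open>obj g\<close> is
    the mean objective, and for each \<open>J\<close> the sum of the \<open>g i (J i)\<close> is at
    most the mean support cost of \<open>J\<close>.\<close>
  define g where "g i j = expectation (\<lambda>\<omega>. \<gamma> (R \<omega>) i j)" for i j
  have "expectation (\<lambda>\<omega>. dual_value k m x p lam (?S (R \<omega>))) \<le> expectation (\<lambda>\<omega>. obj (\<gamma> (R \<omega>)) + e)"
    using opt[OF RI] by (intro integral_mono Bochner_Integration.integrable_add int) (auto intro: less_imp_le simp: diff_less_eq)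
  also have "\<dots> = obj g + e"
    unfolding obj_def g_def
    using int[where h = "\<lambda>\<tau>. \<gamma> \<tau> _ _"] by (simp add: prob_space Bochner_Integration.integral_sum)
  also have "obj g \<le> (1 + 1 / real t) * barycenter_value k m x p lam"
    unfolding obj_def
  proof (rule dual_objective_le_barycenter_value)
    fix J :: "nat \<Rightarrow> nat" and w :: "real ^ 'd"
    assume J: "J \<in> (\<Pi>\<^sub>E i\<in>{1..k}. {1..m i})"
    have "(\<Sum>i\<in>{1..k}. g i (J i)) = expectation (\<lambda>\<omega>. \<Sum>i\<in>{1..k}. \<gamma> (R \<omega>) i (J i))"
      unfolding g_def
      using int[where h = "\<lambda>\<tau>. \<gamma> \<tau> _ _"] by (simp add: Bochner_Integration.integral_sum)
    also have "\<dots> \<le> expectation (\<lambda>\<omega>. support_cost k x lam (?S (R \<omega>)) J)"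
    proof (rule integral_mono)
      fix \<omega> assume "\<omega> \<in> space M"
      from feas[OF RI[OF this]] J
      show "(\<Sum>i\<in>{1..k}. \<gamma> (R \<omega>) i (J i)) \<le> support_cost k x lam (?S (R \<omega>)) J"
        by (auto simp: dual_feasible_def)
    qed (rule int[where h = "\<lambda>\<tau>. \<Sum>i\<in>{1..k}. \<gamma> \<tau> i (J i)"]
              int[where h = "\<lambda>\<tau>. support_cost k x lam (?S \<tau>) J"])+
    also have "\<dots> \<le> (1 + 1 / real t) * (\<Sum>i\<in>{1..k}. lam i * (norm (x i (J i) - w))\<^sup>2)"
      unfolding R_def sampled_averages_restrict using t_range
      by (intro expectation_support_cost_sampled_averages[OF lam_sum _ T_indep T_law J]) simp
    finally show "(\<Sum>i\<in>{1..k}. g i (J i)) \<le> (1 + 1 / real t) * (\<Sum>i\<in>{1..k}. lam i * (norm (x i (J i) - w))\<^sup>2)" .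
  qed (use t_range support_size distinct_atoms p_nonneg p_sum lam_nonneg in \<open>auto intro: add_pos_nonneg\<close>)
  finally show "integral\<^sup>L M (\<lambda>\<omega>. dual_value k m x p lam (?S (\<lambda>r. T r \<omega>)))
      \<le> (1 + 1 / real t) * barycenter_value k m x p lam + e"
    by (simp add: R_def sampled_averages_restrict del: One_nat_def)
qed

end
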